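(* Let $K$ be a semihypergroup. Then $AP_l(K)=AP_r(K)$.
   Context: All topologies are Hausdorff. For a locally compact Hausdorff space $X$: $M(X)$ is the space of regular complex Borel measures on $X$; $M^+(X)$ is the set of finite non-negative regular Borel measures, with the cone topology (the weakest topology making $\mu\mapsto\int_X f\,d\mu$ continuous for every $f\in C_c^+(X)\cup\{1_X\}$, where $C_c^+(X)$ is the set of non-negative compactly supported continuous functions and $1_X$ is the constant function $1$); $\mathfrak{C}(X)$ is the set of compact subsets of $X$ with the Michael topology, generated by the sub-basis of sets $\{C\in\mathfrak{C}(X): C\cap U\neq\emptyset,\ C\subset V\}$ for $U,V$ open in $X$; $p_x$ is the point mass at $x$. A semihypergroup is a pair $(K,* )$ such that: (A1) $K$ is a locally compact Hausdorff space and $*$ is a binary operation making $M(K)$ an associative algebra; (A2) the bilinear map $*$ sends $M^+(K)\times M^+(K)$ into $M^+(K)$ and its restriction to $M^+(K)\times M^+(K)$ is (jointly) continuous; (A3) for all $x,y\in K$, $p_x*p_y$ is a probability measure with compact support; (A4) the map $(x,y)\mapsto \mathrm{supp}(p_x*p_y)$, $K\times K\to\mathfrak{C}(K)$, is continuous. $C(K)$ is the space of bounded continuous complex-valued functions on $K$ with the supremum norm. For measurable $f$ on $K$ and $x,y\in K$, $L_xf(y)=R_yf(x)=f(x*y):=\int_K f\,d(p_x*p_y)$. $AP_r(K)$ (resp. $AP_l(K)$) is the set of $f\in C(K)$ such that $\{R_xf:x\in K\}$ (resp. $\{L_xf:x\in K\}$) is relatively compact in $C(K)$ in the norm topology. 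*)

theory Defs
  imports "HOL-Analysis.Analysis" "HOL-Probability.Probability_Measure"
begin

section \<open>Regular complex Borel measures\<close>

text \<open>A complex Borel measure is a set function that vanishes off the Borel sets; this
  normalisation makes equality of measures the same as equality of functions. The series is
  automatically absolutely convergent, since the union does not depend on the order.\<close>

definition complex_borel_measure :: "('a::topological_space set \<Rightarrow> complex) \<Rightarrow> bool" where
  "complex_borel_measure \<mu> \<longleftrightarrow>
     (\<forall>A. A \<notin> sets borel \<longrightarrow> \<mu> A = 0) \<and>
     (\<forall>F::nat \<Rightarrow> 'a set. range F \<subseteq> sets borel \<longrightarrow> disjoint_family F \<longrightarrow>
        (\<lambda>n. \<mu> (F n)) sums \<mu> (\<Union>n. F n))"

definition total_variation :: "('a::topological_space set \<Rightarrow> complex) \<Rightarrow> 'a set \<Rightarrow> ennreal" where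
  "total_variation \<mu> A =
     (SUP F \<in> {F::nat \<Rightarrow> 'a set. range F \<subseteq> sets borel \<and> disjoint_family F \<and> (\<Union>n. F n) = A}.
        \<Sum>n. ennreal (cmod (\<mu> (F n))))"

definition regular_measure :: "('a::topological_space set \<Rightarrow> complex) \<Rightarrow> bool" where
  "regular_measure \<mu> \<longleftrightarrow>
     (\<forall>A \<in> sets borel.
        total_variation \<mu> A = (INF U \<in> {U. open U \<and> A \<subseteq> U}. total_variation \<mu> U) \<and>
        total_variation \<mu> A = (SUP C \<in> {C. compact C \<and> C \<subseteq> A}. total_variation \<mu> C))"

definition Meas :: "('a::topological_space set \<Rightarrow> complex) set" where
  "Meas = {\<mu>. complex_borel_measure \<mu> \<and> regular_measure \<mu>}"

definition Meas_pos :: "('a::topological_space set \<Rightarrow> complex) set" where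
  "Meas_pos = {\<mu> \<in> Meas. \<forall>A. \<mu> A \<in> \<real> \<and> 0 \<le> Re (\<mu> A)}"

text \<open>The library measure of an element of \<^const>\<open>Meas_pos\<close>; it is meaningful only for
  such set functions.\<close>

definition to_measure :: "('a::topological_space set \<Rightarrow> complex) \<Rightarrow> 'a measure" where
  "to_measure \<mu> = measure_of UNIV (sets borel) (\<lambda>A. ennreal (Re (\<mu> A)))"

definition supp :: "('a::topological_space set \<Rightarrow> complex) \<Rightarrow> 'a set" where
  "supp \<mu> = - \<Union>{U. open U \<and> total_variation \<mu> U = 0}"

definition point_mass :: "'a::topological_space \<Rightarrow> 'a set \<Rightarrow> complex" where
  "point_mass x A = (if A \<in> sets borel \<and> x \<in> A then 1 else 0)"


section \<open>The cone topology and the Michael topology\<close>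

definition Cc_pos :: "('a::topological_space \<Rightarrow> real) set" where
  "Cc_pos = {f. continuous_on UNIV f \<and> (\<forall>x. 0 \<le> f x) \<and> compact (closure {x. f x \<noteq> 0})}"

definition cone_topology :: "('a::topological_space set \<Rightarrow> complex) topology" where
  "cone_topology = topology_generated_by
     {{\<mu> \<in> Meas_pos. (LINT x|to_measure \<mu>. f x) \<in> U} | f U. f \<in> Cc_pos \<union> {\<lambda>_. 1} \<and> open U}"

text \<open>The set of all compact sets is added to the sub-basis because the empty set lies in no
  other member, and \<^const>\<open>topology_generated_by\<close> takes the union of the
  sub-basis as the underlying space.\<close>

definition michael_topology :: "'a::topological_space set topology" where
  "michael_topology = topology_generated_by
     (insert {C. compact C}
       {{C. compact C \<and> C \<inter> U \<noteq> {} \<and> C \<subseteq> V} | U V. open U \<and> open V})"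


section \<open>Semihypergroups\<close>

text \<open>The space $K$ is the type \<open>'a\<close>, and only the values of \<open>conv\<close> on
  \<^const>\<open>Meas\<close> matter.\<close>

type_synonym 'a convolution = "('a set \<Rightarrow> complex) \<Rightarrow> ('a set \<Rightarrow> complex) \<Rightarrow> 'a set \<Rightarrow> complex"

locale semihypergroup =
  fixes conv :: "'a::t2_space convolution"
  assumes locally_compact: "locally_compact_space (euclidean :: 'a topology)"
    and conv_closed: "\<lbrakk>\<mu> \<in> Meas; \<nu> \<in> Meas\<rbrakk> \<Longrightarrow> conv \<mu> \<nu> \<in> Meas"
    and conv_assoc: "\<lbrakk>\<mu> \<in> Meas; \<nu> \<in> Meas; \<rho> \<in> Meas\<rbrakk> \<Longrightarrow> conv (conv \<mu> \<nu>) \<rho> = conv \<mu> (conv \<nu> \<rho>)"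
    and conv_add_left: "\<lbrakk>\<mu> \<in> Meas; \<nu> \<in> Meas; \<rho> \<in> Meas\<rbrakk> \<Longrightarrow>
          conv (\<lambda>A. \<mu> A + \<nu> A) \<rho> = (\<lambda>A. conv \<mu> \<rho> A + conv \<nu> \<rho> A)"
    and conv_add_right: "\<lbrakk>\<mu> \<in> Meas; \<nu> \<in> Meas; \<rho> \<in> Meas\<rbrakk> \<Longrightarrow>
          conv \<rho> (\<lambda>A. \<mu> A + \<nu> A) = (\<lambda>A. conv \<rho> \<mu> A + conv \<rho> \<nu> A)"
    and conv_scale_left: "\<lbrakk>\<mu> \<in> Meas; \<nu> \<in> Meas\<rbrakk> \<Longrightarrow>
          conv (\<lambda>A. c * \<mu> A) \<nu> = (\<lambda>A. c * conv \<mu> \<nu> A)"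
    and conv_scale_right: "\<lbrakk>\<mu> \<in> Meas; \<nu> \<in> Meas\<rbrakk> \<Longrightarrow>
          conv \<mu> (\<lambda>A. c * \<nu> A) = (\<lambda>A. c * conv \<mu> \<nu> A)"
    and conv_pos: "\<lbrakk>\<mu> \<in> Meas_pos; \<nu> \<in> Meas_pos\<rbrakk> \<Longrightarrow> conv \<mu> \<nu> \<in> Meas_pos"
    and conv_continuous:
      "continuous_map (prod_topology cone_topology cone_topology) cone_topology
         (\<lambda>(\<mu>, \<nu>). conv \<mu> \<nu>)"
    and conv_point_mass_prob: "prob_space (to_measure (conv (point_mass x) (point_mass y)))"
    and conv_point_mass_supp: "compact (supp (conv (point_mass x) (point_mass y)))"
    and supp_continuous:
      "continuous_map (prod_topology euclidean euclidean) michael_topology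
         (\<lambda>(x, y). supp (conv (point_mass x) (point_mass y)))"


section \<open>Translates and almost periodic functions\<close>

text \<open>The value $f(x * y)$.\<close>

definition eval_prod :: "'a::topological_space convolution \<Rightarrow> ('a \<Rightarrow> complex) \<Rightarrow> 'a \<Rightarrow> 'a \<Rightarrow> complex" where
  "eval_prod conv f x y = (LINT z|to_measure (conv (point_mass x) (point_mass y)). f z)"

definition left_translate :: "'a::topological_space convolution \<Rightarrow> 'a \<Rightarrow> ('a \<Rightarrow> complex) \<Rightarrow> 'a \<Rightarrow> complex" where
  "left_translate conv x f = (\<lambda>y. eval_prod conv f x y)"

definition right_translate :: "'a::topological_space convolution \<Rightarrow> 'a \<Rightarrow> ('a \<Rightarrow> complex) \<Rightarrow> 'a \<Rightarrow> complex" where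
  "right_translate conv y f = (\<lambda>x. eval_prod conv f x y)"

text \<open>Relative compactness in $C(K)$ of a set of functions on $K$: the functions are bounded and
  continuous, and the closure of the set for the supremum norm, which is the norm of
  \<^typ>\<open>'a \<Rightarrow>\<^sub>C complex\<close>, is compact. The first conjunct keeps
  \<^const>\<open>Bcontfun\<close> on its domain.\<close>

definition relatively_compact_in_C :: "('a::topological_space \<Rightarrow> complex) set \<Rightarrow> bool" where
  "relatively_compact_in_C S \<longleftrightarrow> S \<subseteq> bcontfun \<and> compact (closure (Bcontfun ` S))"

definition AP_l :: "'a::topological_space convolution \<Rightarrow> ('a \<Rightarrow>\<^sub>C complex) set" where
  "AP_l conv = {f. relatively_compact_in_C {left_translate conv x (apply_bcontfun f) | x. True}}"

definition AP_r :: "'a::topological_space convolution \<Rightarrow> ('a \<Rightarrow>\<^sub>C complex) set" where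
  "AP_r conv = {f. relatively_compact_in_C {right_translate conv x (apply_bcontfun f) | x. True}}"

end

theory Submission
  imports Defs "HOL-Probability.Giry_Monad"
begin

text \<open>
  For bounded continuous \<open>f\<close> consider the kernel \<open>F x y = f(x * y)\<close>: the left translates of \<open>f\<close> are
  its rows, the right translates its columns. Two independent facts give the theorem.

  The first one is that total boundedness passes from the rows of a bounded kernel to its columns.
  Since \<open>C(K)\<close> is complete, relative compactness of the rows means that for each \<open>e > 0\<close> finitely
  many rows approximate all of them uniformly up to \<open>e\<close>. A column is then determined up to \<open>2e\<close> by
  its entries in those finitely many rows, and these entries range over a bounded, hence totally
  bounded, subset of a finite-dimensional space. So finitely many columns approximate all columns
  (\<open>finite_nets_transpose\<close>). This is a statement about bounded functions on a product of two sets.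

  The second one is that all translates are continuous. The cone topology only controls
  integrals of compactly supported functions and of \<open>1\<close>. If \<open>g\<close> is a compactly supported cutoff
  function with \<open>0 \<le> g \<le> 1\<close>, the mass of \<open>1 - g\<close> is a continuous function of the measure, and it
  can be made small at a given measure by inner regularity. Therefore mass cannot escape to infinity
  under small perturbations, and integration of any bounded continuous function is continuous in
  the cone topology (\<open>continuous_map_cone_integral\<close>). As \<open>x \<mapsto> p_x\<close> and the convolution are
  continuous for the cone topology, \<open>F\<close> is even jointly continuous.
\<close>

section \<open>Finite nets of rows and columns of a bounded kernel\<close>

text \<open>Two columns that agree up to rounding in the rows of an \<open>e/4\<close>-net differ there by less than
  \<open>e/2\<close>, and passing from an arbitrary row to the net costs \<open>e/4\<close> for each column. Since there are
  only finitely many rounded patterns, one column for each of them suffices.\<close>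

lemma finite_nets_transpose:
  fixes F :: "'a \<Rightarrow> 'b \<Rightarrow> complex"
  assumes bounded: "\<And>x y. cmod (F x y) \<le> B"
    and rows: "\<And>e. e > 0 \<Longrightarrow> \<exists>A. finite A \<and> (\<forall>x. \<exists>a\<in>A. \<forall>y. dist (F x y) (F a y) < e)"
    and "e > 0"
  shows "\<exists>C. finite C \<and> (\<forall>y. \<exists>c\<in>C. \<forall>x. dist (F x y) (F x c) < e)"
proof -
  obtain A where A: "finite A" "\<And>x. \<exists>a\<in>A. \<forall>y. dist (F x y) (F a y) < e/4"
    using rows[of "e/4"] \<open>e > 0\<close> by auto
  have "Met_TC.mtotally_bounded (cball (0::complex) B)"
    by (rule Met_TC.compactin_imp_mtotally_bounded) auto
  then obtain T where T: "finite T" "cball (0::complex) B \<subseteq> (\<Union>t\<in>T. ball t (e/4))"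
    using \<open>e > 0\<close> unfolding Met_TC.mtotally_bounded_def by (metis mball_eq_ball zero_less_divide_iff zero_less_numeral)
  have "\<forall>z\<in>cball 0 B. \<exists>t. t \<in> T \<and> dist t z < e/4"
    using T by fastforce
  then obtain r where r: "\<And>z. z \<in> cball 0 B \<Longrightarrow> r z \<in> T \<and> dist (r z) z < e/4"
    by metis
  \<comment> \<open>The column \<open>y\<close>, restricted to the finitely many rows of the net and rounded to \<open>T\<close>.\<close>
  define code where "code y = (\<lambda>a\<in>A. r (F a y))" for y
  have "range code \<subseteq> A \<rightarrow>\<^sub>E T"
    using r bounded by (auto simp: code_def)
  then have "finite (range code)"
    using finite_PiE[OF A(1), of "\<lambda>_. T"] T(1) by (auto intro: finite_subset)
  then obtain C where C: "finite C" "range code = code ` C"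
    using finite_subset_image[of "range code" code UNIV] by auto
  have "\<exists>c\<in>C. \<forall>x. dist (F x y) (F x c) < e" for y
  proof -
    obtain c where c: "c \<in> C" "code y = code c"
      using C(2) by (metis image_iff rangeI)
    have "dist (F x y) (F x c) < e" for x
    proof -
      obtain a where a: "a \<in> A" "\<And>y. dist (F x y) (F a y) < e/4"
        using A(2) by blast
      have "r (F a y) = r (F a c)"
        using c(2) a(1) by (metis code_def restrict_apply')
      moreover have "dist (r (F a y)) (F a y) < e/4" "dist (r (F a c)) (F a c) < e/4"
        using r bounded by auto
      ultimately have "dist (F a y) (F a c) < e/2"
        using dist_triangle3[of "F a y" "F a c" "r (F a c)"] by simp
      then show ?thesis
        using a(2)[of y] a(2)[of c] dist_triangle[of "F x y" "F x c" "F a y"]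
          dist_triangle[of "F a y" "F x c" "F a c"] dist_commute[of "F x c" "F a c"] by linarith
    qed
    with c(1) show ?thesis by blast
  qed
  with C(1) show ?thesis by blast
qed

lemma complete_bcontfun: "complete (UNIV :: ('a::topological_space \<Rightarrow>\<^sub>C 'b::complete_space) set)"
  unfolding complete_def
proof (intro allI impI)
  fix f :: "nat \<Rightarrow> 'a \<Rightarrow>\<^sub>C 'b"
  assume "(\<forall>n. f n \<in> UNIV) \<and> Cauchy f"
  then have Cauchy: "\<exists>M. \<forall>m\<ge>M. \<forall>n\<ge>M. dist (f m) (f n) < e" if "e > 0" for e
    using that by (simp add: Cauchy_def)
  have "uniformly_Cauchy_on UNIV (\<lambda>n. apply_bcontfun (f n))"
  proof (rule uniformly_Cauchy_onI)
    fix e :: real assume "e > 0"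
    then show "\<exists>M. \<forall>x\<in>UNIV. \<forall>m\<ge>M. \<forall>n\<ge>M. dist (f m x) (f n x) < e"
      using Cauchy[of e] dist_fun_lt_imp_dist_val_lt by blast
  qed
  then obtain g where "uniform_limit UNIV (\<lambda>n. apply_bcontfun (f n)) g sequentially"
    using Cauchy_uniformly_convergent uniformly_convergent_on_def by blast
  from uniform_limit_bcontfunE[OF this sequentially_bot]
  obtain l where "f \<longlonglongrightarrow> l" by metis
  then show "\<exists>l\<in>UNIV. f \<longlonglongrightarrow> l" by blast
qed

lemma relatively_compact_in_C_iff_finite_nets:
  fixes F :: "'b \<Rightarrow> 'a::topological_space \<Rightarrow> complex"
  assumes F: "\<And>x. F x \<in> bcontfun"
  shows "relatively_compact_in_C {F x | x. True} \<longleftrightarrow>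
    (\<forall>e>0. \<exists>A. finite A \<and> (\<forall>x. \<exists>a\<in>A. \<forall>y. dist (F x y) (F a y) < e))"
proof -
  define G where "G x = Bcontfun (F x)" for x
  have G: "apply_bcontfun (G x) = F x" for x
    using F by (simp add: G_def Bcontfun_inverse)
  have "Bcontfun ` {F x | x. True} = range G"
    by (auto simp: G_def)
  moreover have "{F x | x. True} \<subseteq> bcontfun"
    using F by auto
  ultimately have "relatively_compact_in_C {F x | x. True} \<longleftrightarrow> compact (closure (range G))"
    by (simp add: relatively_compact_in_C_def)
  also have "\<dots> \<longleftrightarrow> Met_TC.mtotally_bounded (range G)"
  proof -
    have "Met_TC.mcomplete TYPE('a \<Rightarrow>\<^sub>C complex)"
      by (simp add: complete_bcontfun)
    from Met_TC.mtotally_bounded_eq_compact_closure_of[OF this, of "range G"] show ?thesis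
      by simp
  qed
  also have "\<dots> \<longleftrightarrow> (\<forall>e>0. \<exists>A. finite A \<and> (\<forall>x. \<exists>a\<in>A. dist (G x) (G a) < e))"
  proof -
    have "(\<exists>K. finite K \<and> K \<subseteq> range G \<and> range G \<subseteq> (\<Union>x\<in>K. ball x e)) \<longleftrightarrow>
          (\<exists>A. finite A \<and> (\<forall>x. \<exists>a\<in>A. dist (G x) (G a) < e))" (is "?L \<longleftrightarrow> ?R") for e
    proof
      assume ?L
      then obtain K where K: "finite K" "K \<subseteq> range G" "range G \<subseteq> (\<Union>x\<in>K. ball x e)" by blast
      then obtain A where A: "finite A" "K = G ` A"
        by (metis finite_subset_image)
      have "\<exists>a\<in>A. dist (G x) (G a) < e" for x
      proof -
        have "G x \<in> (\<Union>a\<in>A. ball (G a) e)" using K(3) A(2) by blast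
        then show ?thesis by (auto simp: dist_commute)
      qed
      with A(1) show ?R by blast
    next
      assume ?R
      then obtain A where A: "finite A" "\<And>x. \<exists>a\<in>A. dist (G x) (G a) < e" by blast
      have "range G \<subseteq> (\<Union>x\<in>G ` A. ball x e)"
      proof
        fix h assume "h \<in> range G"
        then obtain x where "h = G x" by blast
        with A(2)[of x] show "h \<in> (\<Union>x\<in>G ` A. ball x e)"
          by (auto simp: dist_commute)
      qed
      moreover have "finite (G ` A)" "G ` A \<subseteq> range G"
        using A(1) by auto
      ultimately show ?L by blast
    qed
    then show ?thesis
      by (simp add: Met_TC.mtotally_bounded_def)
  qed
  also have "\<dots> \<longleftrightarrow> (\<forall>e>0. \<exists>A. finite A \<and> (\<forall>x. \<exists>a\<in>A. \<forall>y. dist (F x y) (F a y) < e))" (is "?L \<longleftrightarrow> ?R")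
  proof
    assume ?L
    moreover have "dist (F x y) (F a y) < e" if "dist (G x) (G a) < e" for x a y e
      using dist_fun_lt_imp_dist_val_lt[OF that, of y] by (simp add: G)
    ultimately show ?R by meson
  next
    assume R: ?R
    show ?L
    proof (intro allI impI)
      fix e :: real assume "e > 0"
      then obtain A where A: "finite A" "\<forall>x. \<exists>a\<in>A. \<forall>y. dist (F x y) (F a y) < e/2"
        using R half_gt_zero by blast
      have "\<exists>a\<in>A. dist (G x) (G a) < e" for x
      proof -
        obtain a where a: "a \<in> A" "\<forall>y. dist (F x y) (F a y) < e/2" using A by blast
        then have "dist (G x) (G a) \<le> e/2" by (intro dist_bound) (simp add: G less_imp_le)
        with a \<open>e > 0\<close> show ?thesis by force
      qed
      with A show "\<exists>A. finite A \<and> (\<forall>x. \<exists>a\<in>A. dist (G x) (G a) < e)" by blast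
    qed
  qed
  finally show ?thesis .
qed

text \<open>Applied to a kernel and to its transpose, this implication yields an equivalence; for the
  kernel \<open>f(x * y)\<close> these are the two inclusions between \<^const>\<open>AP_l\<close> and \<^const>\<open>AP_r\<close>.\<close>

lemma relatively_compact_columns_if_rows:
  fixes F :: "'a::topological_space \<Rightarrow> 'b::topological_space \<Rightarrow> complex"
  assumes bounded: "\<And>x y. cmod (F x y) \<le> B"
    and continuous: "\<And>y. continuous_on UNIV (\<lambda>x. F x y)"
    and rows: "relatively_compact_in_C {F x | x. True}"
  shows "relatively_compact_in_C {\<lambda>x. F x y | y. True}"
proof -
  have row: "F x \<in> bcontfun" for x
    using rows by (auto simp: relatively_compact_in_C_def)
  have column: "(\<lambda>x. F x y) \<in> bcontfun" for y
    using continuous bounded by (auto simp: bcontfun_def bounded_iff)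
  have "\<exists>A. finite A \<and> (\<forall>x. \<exists>a\<in>A. \<forall>y. dist (F x y) (F a y) < e)" if "e > 0" for e
    using rows that relatively_compact_in_C_iff_finite_nets[of F, OF row] by simp
  from finite_nets_transpose[of F, OF bounded this] show ?thesis
    unfolding relatively_compact_in_C_iff_finite_nets[of "\<lambda>y x. F x y", OF column] by simp
qed

section \<open>Positive measures\<close>

lemma
  shows sets_to_measure [simp]: "sets (to_measure \<mu>) = sets borel"
    and space_to_measure [simp]: "space (to_measure \<mu>) = UNIV"
  by (simp_all add: to_measure_def sets.sigma_sets_eq[of borel, simplified])

lemma emeasure_to_measure:
  assumes \<mu>: "complex_borel_measure \<mu>" "\<And>A. 0 \<le> Re (\<mu> A)" and A: "A \<in> sets borel"
  shows "emeasure (to_measure \<mu>) A = ennreal (Re (\<mu> A))"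
  unfolding to_measure_def
proof (rule emeasure_measure_of_sigma)
  show "sigma_algebra UNIV (sets (borel :: 'a measure))"
    using sets.sigma_algebra_axioms[of "borel :: 'a measure"] by simp
  have sums: "(\<lambda>n. \<mu> (F n)) sums \<mu> (\<Union>n. F n)"
    if "range F \<subseteq> sets borel" "disjoint_family F" for F :: "nat \<Rightarrow> 'a set"
    using \<mu>(1) that by (auto simp: complex_borel_measure_def)
  have "(\<lambda>n. \<mu> {}) sums \<mu> {}"
    using sums[of "\<lambda>_. {}"] by (auto simp: disjoint_family_on_def)
  then have "\<mu> {} = 0"
    using summable_const_iff sums_summable by blast
  then show "positive (sets borel) (\<lambda>A. ennreal (Re (\<mu> A)))"
    by (simp add: positive_def)
  show "countably_additive (sets borel) (\<lambda>A. ennreal (Re (\<mu> A)))"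
  proof (rule countably_additiveI)
    fix F :: "nat \<Rightarrow> 'a set"
    assume "range F \<subseteq> sets borel" "disjoint_family F"
    then have "(\<lambda>n. Re (\<mu> (F n))) sums Re (\<mu> (\<Union>n. F n))"
      using sums sums_Re by blast
    then show "(\<Sum>n. ennreal (Re (\<mu> (F n)))) = ennreal (Re (\<mu> (\<Union>n. F n)))"
      using \<mu>(2) by (simp add: suminf_ennreal2 sums_iff)
  qed
qed (rule A)

text \<open>Regularity is expressed through the total variation; for positive set functions this identity
  makes it a property of the measure itself. Every countable Borel partition of \<open>A\<close> yields the same
  sum, by countable additivity.\<close>

lemma total_variation_positive:
  assumes \<mu>: "complex_borel_measure \<mu>" "\<And>A. \<mu> A \<in> \<real>" "\<And>A. 0 \<le> Re (\<mu> A)"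
    and A: "A \<in> sets borel"
  shows "total_variation \<mu> A = emeasure (to_measure \<mu>) A"
proof -
  have cmod: "cmod (\<mu> B) = Re (\<mu> B)" for B
    using \<mu>(2,3)[of B] by (metis Reals_cases Re_complex_of_real abs_of_nonneg norm_of_real)
  have "(\<Sum>n. ennreal (cmod (\<mu> (F n)))) = emeasure (to_measure \<mu>) A"
    if "range F \<subseteq> sets borel" "disjoint_family F" "(\<Union>n. F n) = A" for F :: "nat \<Rightarrow> 'a set"
  proof -
    have "(\<Sum>n. ennreal (cmod (\<mu> (F n)))) = (\<Sum>n. emeasure (to_measure \<mu>) (F n))"
      using that(1) emeasure_to_measure[OF \<mu>(1,3)] by (auto simp: cmod intro!: suminf_cong)
    also have "\<dots> = emeasure (to_measure \<mu>) A"
      using that by (simp add: suminf_emeasure)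
    finally show ?thesis .
  qed
  moreover have "(\<lambda>n::nat. if n = 0 then A else {}) \<in>
      {F. range F \<subseteq> sets borel \<and> disjoint_family F \<and> (\<Union>n. F n) = A}"
    using A by (auto simp: disjoint_family_on_def split: if_splits)
  then have "{F::nat \<Rightarrow> 'a set. range F \<subseteq> sets borel \<and> disjoint_family F \<and> (\<Union>n. F n) = A} \<noteq> {}"
    by blast
  ultimately show ?thesis
    unfolding total_variation_def by (intro SUP_eq_const) auto
qed

lemma Meas_posD:
  assumes "\<mu> \<in> Meas_pos"
  shows "complex_borel_measure \<mu>" "\<mu> A \<in> \<real>" "0 \<le> Re (\<mu> A)" "regular_measure \<mu>"
  using assms by (auto simp: Meas_pos_def Meas_def)

lemma finite_measure_to_measure:
  assumes "\<mu> \<in> Meas_pos"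
  shows "finite_measure (to_measure \<mu>)"
  by (rule finite_measureI) (simp add: emeasure_to_measure Meas_posD[OF assms])

lemma integrable_to_measure:
  fixes f :: "'a::topological_space \<Rightarrow> 'b::{banach,second_countable_topology}"
  assumes "\<mu> \<in> Meas_pos" "continuous_on UNIV f" "\<And>x. norm (f x) \<le> B"
  shows "integrable (to_measure \<mu>) f"
proof -
  interpret finite_measure "to_measure \<mu>" by (rule finite_measure_to_measure) fact
  have "f \<in> borel_measurable (to_measure \<mu>)"
    using borel_measurable_continuous_onI[OF assms(2)] by (simp cong: measurable_cong_sets)
  then show ?thesis
    using assms(3) by (intro integrable_const_bound[of _ B]) auto
qed

lemma Meas_pos_tight:
  fixes \<mu> :: "'a::t2_space set \<Rightarrow> complex"
  assumes \<mu>: "\<mu> \<in> Meas_pos" and "e > 0"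
  obtains C where "compact C" "measure (to_measure \<mu>) UNIV < measure (to_measure \<mu>) C + e"
proof (cases "measure (to_measure \<mu>) UNIV < e")
  \<comment> \<open>Separated because \<^const>\<open>ennreal\<close> would truncate the difference of the mass and \<open>e\<close> below.\<close>
  case True
  then show ?thesis using that[of "{}"] by simp
next
  case False
  interpret finite_measure "to_measure \<mu>" by (rule finite_measure_to_measure) fact
  let ?m = "measure (to_measure \<mu>) UNIV"
  have tv: "total_variation \<mu> A = emeasure (to_measure \<mu>) A" if "A \<in> sets borel" for A
    using that by (intro total_variation_positive Meas_posD[OF \<mu>])
  have "ennreal (?m - e) < total_variation \<mu> UNIV"
    using False \<open>e > 0\<close> by (simp add: tv emeasure_eq_measure ennreal_less_iff)
  also have "\<dots> = (SUP C \<in> {C. compact C}. total_variation \<mu> C)"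
    using bspec[OF Meas_posD(4)[OF \<mu>, unfolded regular_measure_def] space_in_borel, THEN conjunct2]
    by (simp only: subset_UNIV simp_thms)
  finally obtain C where C: "compact C" "ennreal (?m - e) < total_variation \<mu> C"
    by (auto simp: less_SUP_iff)
  have "C \<in> sets borel"
    using C(1) by (simp add: borel_closed compact_imp_closed)
  then have "?m - e < measure (to_measure \<mu>) C"
    using C(2) False by (simp add: tv emeasure_eq_measure ennreal_less_iff)
  then show ?thesis using that C(1) by simp
qed

section \<open>The cone topology integrates bounded continuous functions continuously\<close>

lemma topspace_cone_topology: "topspace cone_topology = Meas_pos"
  unfolding cone_topology_def topology_generated_by_topspace by blast

lemma continuous_map_cone_integral_generator:
  assumes "f \<in> Cc_pos \<union> {\<lambda>_. 1}"
  shows "continuous_map cone_topology euclideanreal (\<lambda>\<mu>. LINT x|to_measure \<mu>. f x)"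
  unfolding continuous_map_def topspace_cone_topology
proof (intro conjI allI impI)
  fix U :: "real set" assume "openin euclidean U"
  then show "openin cone_topology {\<mu> \<in> Meas_pos. (LINT x|to_measure \<mu>. f x) \<in> U}"
    unfolding cone_topology_def using assms by (intro topology_generated_by_Basis) auto
qed auto

lemma compact_cutoff:
  fixes C :: "'a::t2_space set"
  assumes "locally_compact_space (euclidean :: 'a topology)" "compact C"
  obtains g where "g \<in> Cc_pos" "\<And>x. g x \<le> 1" "\<And>x. x \<in> C \<Longrightarrow> g x = 1"
proof -
  have haus: "Hausdorff_space (euclidean :: 'a topology)"
    unfolding Hausdorff_space_def disjnt_def by (simp; metis hausdorff)
  obtain U L where UL: "open U" "compact L" "C \<subseteq> U" "U \<subseteq> L"
    using assms haus locally_compact_space_compact_closed_compact[of "euclidean :: 'a topology"]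
    by auto
  have "completely_regular_space (euclidean :: 'a topology)"
    using assms(1) haus by (simp add: locally_compact_regular_imp_completely_regular_space)
  then obtain g where g: "continuous_map euclidean (top_of_set {0..1::real}) g" "g ` (-U) \<subseteq> {0}" "g ` C \<subseteq> {1}"
  proof -
    have "compactin euclidean C" "closedin euclidean (-U)" "disjnt C (-U)"
      using UL assms(2) by (auto simp: disjnt_def)
    from Urysohn_completely_regular_compact_closed[OF zero_le_one
        \<open>completely_regular_space _\<close> this]
    show ?thesis using that by metis
  qed
  have "closure {x. g x \<noteq> 0} \<subseteq> L"
    using g(2) UL by (intro closure_minimal compact_imp_closed) auto
  then have "compact (closure {x. g x \<noteq> 0})"
    using compact_Int_closed[OF UL(2) closed_closure] by (metis inf.absorb2)
  moreover have "continuous_on UNIV g" "\<And>x. g x \<in> {0..1}"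
    using g(1) by (auto simp: continuous_map_in_subtopology)
  ultimately show ?thesis
    using that[of g] g(3) by (auto simp: Cc_pos_def)
qed

text \<open>For a cutoff function \<open>g\<close>, replacing \<open>h\<close> by the compactly supported function \<open>h * g\<close> changes
  the integral by at most \<open>B\<close> times the defect, which is the integral of \<open>1 - g\<close>. Both the integral
  of \<open>h * g\<close> and the defect are continuous in the cone topology, so a cutoff with small defect at
  \<open>\<mu>\<^sub>0\<close> also has small defect near \<open>\<mu>\<^sub>0\<close>. Nonnegativity of \<open>h\<close> makes \<open>h * g\<close> a test function of
  the cone topology.\<close>

lemma continuous_map_cone_integral_nonneg:
  fixes h :: "'a::t2_space \<Rightarrow> real"
  assumes lc: "locally_compact_space (euclidean :: 'a topology)"
    and h: "continuous_on UNIV h" "\<And>x. 0 \<le> h x" "\<And>x. h x \<le> B"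
  shows "continuous_map cone_topology euclideanreal (\<lambda>\<mu>. LINT x|to_measure \<mu>. h x)"
proof -
  let ?I = "\<lambda>f \<mu>. LINT x|to_measure \<mu>. f x"
  let ?c = "cone_topology :: ('a set \<Rightarrow> complex) topology"
  have "B \<ge> 0" using h(2,3)[of undefined] by linarith
  have "\<exists>U. openin ?c U \<and> \<mu>\<^sub>0 \<in> U \<and> (\<forall>\<mu>\<in>U. ?I h \<mu> \<in> Met_TC.mball (?I h \<mu>\<^sub>0) e)"
    if \<mu>\<^sub>0: "\<mu>\<^sub>0 \<in> Meas_pos" and "e > 0" for \<mu>\<^sub>0 e
  proof -
    \<comment> \<open>The summand \<open>1\<close> covers \<open>B = 0\<close>.\<close>
    define d where "d = e / (3 * (B + 1))"
    have "d > 0" "B * d \<le> e/3"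
      using \<open>e > 0\<close> \<open>B \<ge> 0\<close> by (auto simp: d_def field_simps)
    obtain C where C: "compact C" "measure (to_measure \<mu>\<^sub>0) UNIV < measure (to_measure \<mu>\<^sub>0) C + d"
      using Meas_pos_tight[OF \<mu>\<^sub>0 \<open>d > 0\<close>] .
    obtain g where g: "g \<in> Cc_pos" "\<And>x. g x \<le> 1" "\<And>x. x \<in> C \<Longrightarrow> g x = 1"
      using compact_cutoff[OF lc C(1)] by blast
    have g_cont: "continuous_on UNIV g" and g_nonneg: "\<And>x. 0 \<le> g x"
      using g(1) by (auto simp: Cc_pos_def)
    have hg: "(\<lambda>x. h x * g x) \<in> Cc_pos"
    proof -
      have "closure {x. h x * g x \<noteq> 0} \<subseteq> closure {x. g x \<noteq> 0}"
        by (intro closure_mono) auto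
      moreover have "compact (closure {x. g x \<noteq> 0})" using g(1) by (auto simp: Cc_pos_def)
      ultimately have "compact (closure {x. h x * g x \<noteq> 0})"
        using compact_Int_closed[of "closure {x. g x \<noteq> 0}" "closure {x. h x * g x \<noteq> 0}"]
        by (simp only: closed_closure inf.absorb2)
      then show ?thesis
        using g_cont g_nonneg h by (simp add: Cc_pos_def continuous_on_mult)
    qed
    define defect where "defect \<mu> = ?I (\<lambda>_. 1) \<mu> - ?I g \<mu>" for \<mu>
    have integrable: "integrable (to_measure \<mu>) g" "integrable (to_measure \<mu>) h"
      "integrable (to_measure \<mu>) (\<lambda>x. h x * g x)" "integrable (to_measure \<mu>) (\<lambda>x. 1 :: real)"
      if "\<mu> \<in> Meas_pos" for \<mu>
    proof -
      have hg_le: "h x * g x \<le> B" for x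
        using mult_mono[of "h x" B "g x" 1] h g_nonneg g(2) \<open>B \<ge> 0\<close> by simp
      show "integrable (to_measure \<mu>) g" "integrable (to_measure \<mu>) (\<lambda>x. 1 :: real)"
        by (rule integrable_to_measure[OF that, of _ 1];
            use g_cont g_nonneg g(2) in \<open>simp add: abs_of_nonneg\<close>)+
      show "integrable (to_measure \<mu>) h" "integrable (to_measure \<mu>) (\<lambda>x. h x * g x)"
        by (rule integrable_to_measure[OF that, of _ B];
            use g_cont g_nonneg h hg_le in \<open>simp add: continuous_on_mult abs_of_nonneg\<close>)+
    qed
    have cut: "\<bar>?I h \<mu> - ?I (\<lambda>x. h x * g x) \<mu>\<bar> \<le> B * defect \<mu>" if \<mu>: "\<mu> \<in> Meas_pos" for \<mu>
    proof -
      have "?I h \<mu> - ?I (\<lambda>x. h x * g x) \<mu> = (LINT x|to_measure \<mu>. h x * (1 - g x))"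
        using integrable[OF \<mu>] by (simp add: right_diff_distrib)
      moreover have "\<dots> \<le> (LINT x|to_measure \<mu>. B * (1 - g x))"
      proof (rule integral_mono)
        show "integrable (to_measure \<mu>) (\<lambda>x. h x * (1 - g x))"
          using integrable[OF \<mu>] by (simp add: right_diff_distrib)
        show "integrable (to_measure \<mu>) (\<lambda>x. B * (1 - g x))"
          using integrable[OF \<mu>] by (intro integrable_mult_right Bochner_Integration.integrable_diff)
        show "h x * (1 - g x) \<le> B * (1 - g x)" for x
          using h g(2)[of x] by (intro mult_right_mono) auto
      qed
      moreover have "(LINT x|to_measure \<mu>. B * (1 - g x)) = B * defect \<mu>"
        using integrable[OF \<mu>] by (simp add: defect_def)
      moreover have "0 \<le> (LINT x|to_measure \<mu>. h x * (1 - g x))"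
        using h g(2) by (intro integral_nonneg_AE) auto
      ultimately show ?thesis by linarith
    qed
    have "measure (to_measure \<mu>\<^sub>0) C \<le> ?I g \<mu>\<^sub>0"
    proof -
      interpret finite_measure "to_measure \<mu>\<^sub>0" by (rule finite_measure_to_measure) fact
      have "C \<in> sets borel" using C(1) by (simp add: borel_closed compact_imp_closed)
      then have "measure (to_measure \<mu>\<^sub>0) C = (LINT x|to_measure \<mu>\<^sub>0. indicator C x)"
        by simp
      also have "\<dots> \<le> ?I g \<mu>\<^sub>0"
      proof (rule integral_mono)
        show "integrable (to_measure \<mu>\<^sub>0) (indicator C :: 'a \<Rightarrow> real)"
          using \<open>C \<in> sets borel\<close> by (simp add: emeasure_eq_measure)
        show "integrable (to_measure \<mu>\<^sub>0) g" by (rule integrable[OF \<mu>\<^sub>0])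
        show "indicator C x \<le> g x" for x using g(3) g_nonneg by (simp add: indicator_def)
      qed
      finally show ?thesis .
    qed
    then have defect0: "defect \<mu>\<^sub>0 < d"
      using C(2) by (simp add: defect_def)
    define U where "U = {\<mu> \<in> topspace ?c. defect \<mu> \<in> {..<d}} \<inter>
      {\<mu> \<in> topspace ?c. ?I (\<lambda>x. h x * g x) \<mu> \<in> ball (?I (\<lambda>x. h x * g x) \<mu>\<^sub>0) (e/3)}"
    have "continuous_map ?c euclideanreal defect"
      unfolding defect_def using g(1)
      by (intro continuous_map_diff continuous_map_cone_integral_generator) auto
    then have "openin ?c U"
      unfolding U_def using hg
      by (intro openin_Int openin_continuous_map_preimage[where Y=euclideanreal]
          continuous_map_cone_integral_generator) auto
    moreover have "\<mu>\<^sub>0 \<in> U"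
      using defect0 \<mu>\<^sub>0 \<open>e > 0\<close> by (simp add: U_def topspace_cone_topology)
    moreover have "?I h \<mu> \<in> Met_TC.mball (?I h \<mu>\<^sub>0) e" if "\<mu> \<in> U" for \<mu>
    proof -
      have \<mu>: "\<mu> \<in> Meas_pos" "defect \<mu> < d"
        "\<bar>?I (\<lambda>x. h x * g x) \<mu>\<^sub>0 - ?I (\<lambda>x. h x * g x) \<mu>\<bar> < e/3"
        using that by (auto simp: U_def topspace_cone_topology dist_real_def)
      have "B * defect \<mu> \<le> e/3" "B * defect \<mu>\<^sub>0 \<le> e/3"
        using \<mu>(2) defect0 \<open>B \<ge> 0\<close> \<open>B * d \<le> e/3\<close>
        by (meson less_imp_le mult_left_mono order_trans)+
      then have "\<bar>?I h \<mu>\<^sub>0 - ?I h \<mu>\<bar> < e"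
        using cut[OF \<mu>(1)] cut[OF \<mu>\<^sub>0] \<mu>(3) by linarith
      then show ?thesis by (simp add: dist_real_def)
    qed
    ultimately show ?thesis by blast
  qed
  then have "continuous_map ?c Met_TC.mtopology (?I h)"
    by (subst Met_TC.continuous_map_to_metric) (auto simp: topspace_cone_topology)
  then show ?thesis by simp
qed

lemma continuous_map_cone_integral:
  fixes f :: "'a::t2_space \<Rightarrow> complex"
  assumes lc: "locally_compact_space (euclidean :: 'a topology)"
    and f: "continuous_on UNIV f" "\<And>x. cmod (f x) \<le> B"
  shows "continuous_map cone_topology euclidean (\<lambda>\<mu>. LINT x|to_measure \<mu>. f x)"
proof -
  \<comment> \<open>A bounded real function is a nonnegative one minus a constant, and the mass is continuous.\<close>
  have real: "continuous_map cone_topology euclideanreal (\<lambda>\<mu>. LINT x|to_measure \<mu>. u x)"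
    if u: "continuous_on UNIV u" "\<And>x. \<bar>u x\<bar> \<le> B" for u :: "'a \<Rightarrow> real"
  proof (rule continuous_map_eq)
    have "0 \<le> u x + B" "u x + B \<le> 2 * B" for x using u(2)[of x] by linarith+
    with u(1) have "continuous_map cone_topology euclideanreal (\<lambda>\<mu>. LINT x|to_measure \<mu>. u x + B)"
      by (intro continuous_map_cone_integral_nonneg[OF lc] continuous_intros)
    then show "continuous_map cone_topology euclideanreal
        (\<lambda>\<mu>. (LINT x|to_measure \<mu>. u x + B) - B * (LINT x|to_measure \<mu>. 1))"
      using continuous_map_cone_integral_generator[of "\<lambda>_. 1"]
      by (intro continuous_map_diff continuous_map_real_mult_left) auto
    fix \<mu> :: "'a set \<Rightarrow> complex" assume "\<mu> \<in> topspace cone_topology"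
    then have \<mu>: "\<mu> \<in> Meas_pos" by (simp add: topspace_cone_topology)
    interpret finite_measure "to_measure \<mu>" by (rule finite_measure_to_measure) fact
    show "(LINT x|to_measure \<mu>. u x + B) - B * (LINT x|to_measure \<mu>. 1) = (LINT x|to_measure \<mu>. u x)"
      using integrable_to_measure[OF \<mu> u(1), of B] u(2) by simp
  qed
  have "continuous_map cone_topology euclideanreal (\<lambda>\<mu>. LINT x|to_measure \<mu>. Re (f x))"
    "continuous_map cone_topology euclideanreal (\<lambda>\<mu>. LINT x|to_measure \<mu>. Im (f x))"
    using f abs_Re_le_cmod abs_Im_le_cmod by (auto intro!: real continuous_intros intro: order_trans)
  then have "continuous_map cone_topology euclidean
      (\<lambda>\<mu>. complex_of_real (LINT x|to_measure \<mu>. Re (f x)) + \<i> * complex_of_real (LINT x|to_measure \<mu>. Im (f x)))"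
    by (simp add: continuous_map_atin tendsto_intros)
  then show ?thesis
  proof (rule continuous_map_eq)
    fix \<mu> :: "'a set \<Rightarrow> complex" assume "\<mu> \<in> topspace cone_topology"
    then have "integrable (to_measure \<mu>) f"
      using f by (auto simp: topspace_cone_topology intro!: integrable_to_measure)
    then show "complex_of_real (LINT x|to_measure \<mu>. Re (f x)) + \<i> * complex_of_real (LINT x|to_measure \<mu>. Im (f x)) = (LINT x|to_measure \<mu>. f x)"
      by (simp add: complex_eq_iff)
  qed
qed

section \<open>Point masses and the kernel of translates\<close>

lemma to_measure_point_mass: "to_measure (point_mass x) = return borel x"
  unfolding to_measure_def return_def
  by (subst space_borel, rule measure_of_eq) (auto simp: point_mass_def indicator_def sets.sigma_sets_eq[of borel, simplified])

lemma point_mass_Meas_pos: "point_mass (x::'a::t2_space) \<in> Meas_pos"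
proof -
  have cbm: "complex_borel_measure (point_mass x)"
    unfolding complex_borel_measure_def
  proof (intro conjI allI impI)
    fix F :: "nat \<Rightarrow> 'a set"
    assume F: "range F \<subseteq> sets borel" "disjoint_family F"
    show "(\<lambda>n. point_mass x (F n)) sums point_mass x (\<Union>n. F n)"
    proof (cases "x \<in> (\<Union>n. F n)")
      case True
      then obtain k where k: "x \<in> F k" by blast
      then have "x \<in> F n \<longleftrightarrow> n = k" for n
        using F(2) by (auto simp: disjoint_family_on_def)
      then have "(\<lambda>n. point_mass x (F n)) = (\<lambda>n. if n = k then 1 else 0)"
        using F(1) by (auto simp: point_mass_def)
      moreover have "point_mass x (\<Union>n. F n) = 1"
        using F(1) True by (auto simp: point_mass_def)
      ultimately show ?thesis using sums_single[of k "\<lambda>_. 1::complex"] by simp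
    next
      case False
      then show ?thesis by (simp add: point_mass_def)
    qed
  qed (simp add: point_mass_def)
  have tv: "total_variation (point_mass x) A = indicator A x" if "A \<in> sets borel" for A
    using that cbm by (subst total_variation_positive) (auto simp: to_measure_point_mass point_mass_def)
  have "regular_measure (point_mass x)"
    unfolding regular_measure_def
  proof (intro ballI conjI)
    fix A :: "'a set" assume A: "A \<in> sets borel"
    show "total_variation (point_mass x) A = (INF U \<in> {U. open U \<and> A \<subseteq> U}. total_variation (point_mass x) U)"
    proof (rule antisym)
      show "total_variation (point_mass x) A \<le> (INF U \<in> {U. open U \<and> A \<subseteq> U}. total_variation (point_mass x) U)"
        using A by (auto intro!: INF_greatest simp: tv indicator_def)
      show "(INF U \<in> {U. open U \<and> A \<subseteq> U}. total_variation (point_mass x) U) \<le> total_variation (point_mass x) A"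
        using A by (intro INF_lower2[of "if x \<in> A then UNIV else - {x}"]) (auto simp: tv)
    qed
    have le: "total_variation (point_mass x) C \<le> total_variation (point_mass x) A" if "compact C" "C \<subseteq> A" for C
      using that A by (auto simp: tv indicator_def borel_closed compact_imp_closed)
    show "total_variation (point_mass x) A = (SUP C \<in> {C. compact C \<and> C \<subseteq> A}. total_variation (point_mass x) C)"
    proof (rule antisym)
      show "total_variation (point_mass x) A \<le> (SUP C \<in> {C. compact C \<and> C \<subseteq> A}. total_variation (point_mass x) C)"
        using A by (intro SUP_upper2[of "if x \<in> A then {x} else {}"]) (auto simp: tv)
      show "(SUP C \<in> {C. compact C \<and> C \<subseteq> A}. total_variation (point_mass x) C) \<le> total_variation (point_mass x) A"
        using le by (auto intro!: SUP_least)
    qed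
  qed
  with cbm show ?thesis
    by (auto simp: Meas_pos_def Meas_def point_mass_def)
qed

text \<open>Integration against a point mass is evaluation, so a sub-basic set given by a test function \<open>f\<close>
  and an open set \<open>U\<close> pulls back to \<open>f -` U\<close>.\<close>

lemma continuous_map_point_mass:
  "continuous_map euclidean cone_topology (point_mass :: 'a::t2_space \<Rightarrow> _)"
  unfolding cone_topology_def
proof (rule continuous_on_generated_topo)
  fix W :: "('a set \<Rightarrow> complex) set"
  assume "W \<in> {{\<mu> \<in> Meas_pos. (LINT x|to_measure \<mu>. f x) \<in> U} | f U. f \<in> Cc_pos \<union> {\<lambda>_. 1} \<and> open U}"
  then obtain f U where W: "W = {\<mu> \<in> Meas_pos. (LINT x|to_measure \<mu>. f x) \<in> U}"
    and f: "f \<in> Cc_pos \<union> {\<lambda>_. 1}" and U: "open U" by blast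
  have f_cont: "continuous_on UNIV f" using f by (auto simp: Cc_pos_def)
  have "(LINT x|to_measure (point_mass y). f x) = f y" for y
    using borel_measurable_continuous_onI[OF f_cont]
    by (simp add: to_measure_point_mass integral_return)
  then have "point_mass -` W \<inter> topspace euclidean = f -` U"
    by (auto simp: W point_mass_Meas_pos)
  then show "openin euclidean (point_mass -` W \<inter> topspace euclidean)"
    using U f_cont by (simp add: open_vimage)
next
  show "point_mass ` topspace (euclidean :: 'a topology) \<subseteq> \<Union> {{\<mu> \<in> Meas_pos. (LINT x|to_measure \<mu>. f x) \<in> U} | f U. f \<in> Cc_pos \<union> {\<lambda>_. 1} \<and> open U}"
    using point_mass_Meas_pos
    by (auto simp: topspace_cone_topology[unfolded cone_topology_def topology_generated_by_topspace])
qed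

context semihypergroup
begin

lemma continuous_map_eval_prod:
  assumes f: "continuous_on UNIV f" "\<And>z. cmod (f z) \<le> B"
  shows "continuous_map (prod_topology euclidean euclidean) euclidean (\<lambda>(x, y). eval_prod conv f x y)"
proof -
  have "continuous_map (prod_topology euclidean euclidean) (prod_topology cone_topology cone_topology)
      (\<lambda>p. (point_mass (fst p), point_mass (snd p)) :: ('a set \<Rightarrow> complex) \<times> ('a set \<Rightarrow> complex))"
    by (intro continuous_map_pairedI continuous_map_compose[OF continuous_map_fst continuous_map_point_mass, unfolded o_def]
        continuous_map_compose[OF continuous_map_snd continuous_map_point_mass, unfolded o_def])
  from continuous_map_compose[OF this continuous_map_compose[OF conv_continuous
        continuous_map_cone_integral[OF locally_compact f]]]
  show ?thesis by (simp add: o_def eval_prod_def case_prod_beta)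
qed

lemma continuous_on_eval_prod:
  assumes f: "continuous_on UNIV f" "\<And>z. cmod (f z) \<le> B"
  shows "continuous_on UNIV (eval_prod conv f x)" "continuous_on UNIV (\<lambda>x. eval_prod conv f x y)"
proof -
  have "continuous_map euclidean euclidean (eval_prod conv f x)"
    using continuous_map_compose[OF continuous_map_pairedI[OF _ _] continuous_map_eval_prod[OF f],
        of euclidean "\<lambda>_. x" "\<lambda>y. y"] by (simp add: o_def)
  moreover have "continuous_map euclidean euclidean (\<lambda>x. eval_prod conv f x y)"
    using continuous_map_compose[OF continuous_map_pairedI[OF _ _] continuous_map_eval_prod[OF f],
        of euclidean "\<lambda>x. x" "\<lambda>_. y"] by (simp add: o_def)
  ultimately show "continuous_on UNIV (eval_prod conv f x)" "continuous_on UNIV (\<lambda>x. eval_prod conv f x y)"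
    by simp_all
qed

lemma eval_prod_bound:
  assumes f: "continuous_on UNIV f" "\<And>z. cmod (f z) \<le> B"
  shows "cmod (eval_prod conv f x y) \<le> B"
proof -
  let ?M = "to_measure (conv (point_mass x) (point_mass y))"
  interpret prob_space ?M by (rule conv_point_mass_prob)
  have "integrable ?M f"
    using f conv_pos point_mass_Meas_pos by (intro integrable_to_measure) auto
  then have "cmod (LINT z|?M. f z) \<le> (LINT z|?M. cmod (f z))"
    by (intro integral_norm_bound)
  also have "\<dots> \<le> (LINT z|?M. B)"
    using \<open>integrable ?M f\<close> f(2) by (intro integral_mono) auto
  finally show ?thesis
    by (simp add: eval_prod_def prob_space[simplified])
qed

end

theorem corollary4p4:
  fixes conv :: "'a::t2_space convolution"
  assumes "semihypergroup conv"
  shows "AP_l conv = AP_r conv"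
proof -
  interpret semihypergroup conv by fact
  have "f \<in> AP_l conv \<longleftrightarrow> f \<in> AP_r conv" for f
  proof -
    let ?F = "eval_prod conv (apply_bcontfun f)"
    have f: "continuous_on UNIV (apply_bcontfun f)" "cmod (apply_bcontfun f z) \<le> norm f" for z
      by (simp_all add: norm_bounded)
    note bound = eval_prod_bound[OF f] and cont = continuous_on_eval_prod[OF f]
    have "relatively_compact_in_C {?F x | x. True} \<longleftrightarrow> relatively_compact_in_C {\<lambda>x. ?F x y | y. True}"
      using relatively_compact_columns_if_rows[of ?F, OF bound cont(2)]
        relatively_compact_columns_if_rows[of "\<lambda>y x. ?F x y", OF bound cont(1)] by blast
    then show ?thesis
      by (simp add: AP_l_def AP_r_def left_translate_def right_translate_def)
  qed
  then show ?thesis by blast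
qed

end
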